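(* Let $p,q\ge 0$ be integers and let $a_1,\dots,a_p,b_1,\dots,b_q$ be arbitrary constants. For every integer $N\ge 0$ put $$F_N(x)={}_{p+N+1}F_{q+N+1}\Bigl(a_1,\dots,a_p,\tfrac{\alpha+1}{\gamma},\tfrac{\alpha+\beta+1}{\gamma},\dots,\tfrac{\alpha+N\beta+1}{\gamma};\,b_1,\dots,b_q,\tfrac{\alpha+\gamma+1}{\gamma},\tfrac{\alpha+\gamma+\beta+1}{\gamma},\dots,\tfrac{\alpha+\gamma+N\beta+1}{\gamma};\,\lambda x^{\gamma}\Bigr).$$ Then, for any constants $\alpha,\beta,\eta,\lambda$ and any nonzero constant $\gamma$, $$\int x^\alpha \sin(\eta x^\beta)\,{}_pF_q(a_1,\dots,a_p;b_1,\dots,b_q;\lambda x^{\gamma})\,dx = x^{\alpha+1}\sin(\eta x^\beta)\sum_{j=0}^{\infty}\frac{(-1)^j(\beta\eta x^\beta)^{2j}}{\prod_{m=0}^{2j}(\alpha+m\beta+1)}\,F_{2j}(x)-x^{\alpha+1}\cos(\eta x^\beta)\sum_{j=0}^{\infty}\frac{(-1)^j(\beta\eta x^\beta)^{2j+1}}{\prod_{m=0}^{2j+1}(\alpha+m\beta+1)}\,F_{2j+1}(x)+C,$$ where $C$ is an arbitrary constant of integration.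
   Context: Constants are real or complex. The generalized hypergeometric function is defined by the series $${}_pF_q(a_1,\dots,a_p;b_1,\dots,b_q;x)=\sum_{n=0}^{\infty}\frac{(a_1)_n\cdots(a_p)_n}{(b_1)_n\cdots(b_q)_n}\frac{x^n}{n!},$$ with Pochhammer symbol $(\vartheta)_n=\Gamma(\vartheta+n)/\Gamma(\vartheta)$, $(\vartheta)_0=1$. The integral is an indefinite integral (antiderivative) in $x$.
   Formalization: Constants must keep all parameters and denominators admissible and the integrand's series convergent; if γ/β is a negative irrational real and (α+1)/β is real, convergence of the two sums over j is assumed (it can fail for Liouville γ/β); otherwise it is proved. *)

theory Defs
  imports "HOL-Analysis.Analysis"
begin

definition hypergeo_term :: "complex list \<Rightarrow> complex list \<Rightarrow> complex \<Rightarrow> nat \<Rightarrow> complex" where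
  "hypergeo_term as bs z n = fps_nth (fps_hypergeo as bs 1) n * z ^ n"

definition hypergeo :: "complex list \<Rightarrow> complex list \<Rightarrow> complex \<Rightarrow> complex" where
  "hypergeo as bs z = eval_fps (fps_hypergeo as bs 1) z"

text \<open>Consistency with the usual series definition of the generalized hypergeometric function.\<close>

lemma hypergeo_term_altdef:
  "hypergeo_term as bs z n =
     (\<Prod>a\<leftarrow>as. pochhammer a n) / (\<Prod>b\<leftarrow>bs. pochhammer b n) * z ^ n / fact n"
proof -
  have "foldl (\<lambda>r a. r * pochhammer a n) c xs = c * (\<Prod>a\<leftarrow>xs. pochhammer a n)"
    for c :: complex and xs
    by (induction xs arbitrary: c) (simp_all add: mult_ac)
  then show ?thesis
    by (simp add: hypergeo_term_def fps_hypergeo_def)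
qed

lemma hypergeo_altdef: "hypergeo as bs z = (\<Sum>n. hypergeo_term as bs z n)"
  by (simp add: hypergeo_def eval_fps_def hypergeo_term_def)

text \<open>
  The power $x^a$ for the branch \<open>L\<close> of the logarithm. For \<open>L = Ln\<close> and \<open>x \<noteq> 0\<close>
  it is the principal value \<open>x powr a\<close>; for integer \<open>a\<close> it is the ordinary power,
  whatever the branch.
\<close>

definition branch_pow :: "(complex \<Rightarrow> complex) \<Rightarrow> complex \<Rightarrow> complex \<Rightarrow> complex" where
  "branch_pow L x a = exp (a * L x)"

lemma branch_pow_Ln: "x \<noteq> 0 \<Longrightarrow> branch_pow Ln x a = x powr a"
  by (simp add: branch_pow_def powr_def)

lemma branch_pow_of_nat: "exp (L x) = x \<Longrightarrow> branch_pow L x (of_nat n) = x ^ n"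
  by (simp add: branch_pow_def exp_of_nat_mult)

definition upper_params ::
    "complex list \<Rightarrow> complex \<Rightarrow> complex \<Rightarrow> complex \<Rightarrow> nat \<Rightarrow> complex list" where
  "upper_params as \<alpha> \<beta> \<gamma> N = as @ map (\<lambda>m. (\<alpha> + of_nat m * \<beta> + 1) / \<gamma>) [0..<Suc N]"

definition lower_params ::
    "complex list \<Rightarrow> complex \<Rightarrow> complex \<Rightarrow> complex \<Rightarrow> nat \<Rightarrow> complex list" where
  "lower_params bs \<alpha> \<beta> \<gamma> N = bs @ map (\<lambda>m. (\<alpha> + \<gamma> + of_nat m * \<beta> + 1) / \<gamma>) [0..<Suc N]"

text \<open>
  In the next three definitions \<open>xb\<close> stands for $x^\beta$ and \<open>z\<close> for $\lambda x^\gamma$.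
\<close>

definition F_fun ::
    "complex list \<Rightarrow> complex list \<Rightarrow> complex \<Rightarrow> complex \<Rightarrow> complex \<Rightarrow> nat \<Rightarrow> complex \<Rightarrow> complex" where
  "F_fun as bs \<alpha> \<beta> \<gamma> N z =
     hypergeo (upper_params as \<alpha> \<beta> \<gamma> N) (lower_params bs \<alpha> \<beta> \<gamma> N) z"

definition even_term ::
    "complex list \<Rightarrow> complex list \<Rightarrow> complex \<Rightarrow> complex \<Rightarrow> complex \<Rightarrow> complex \<Rightarrow>
     complex \<Rightarrow> complex \<Rightarrow> nat \<Rightarrow> complex" where
  "even_term as bs \<alpha> \<beta> \<gamma> \<eta> xb z j =
     (-1) ^ j * (\<beta> * \<eta> * xb) ^ (2 * j) / (\<Prod>m=0..2 * j. \<alpha> + of_nat m * \<beta> + 1)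
       * F_fun as bs \<alpha> \<beta> \<gamma> (2 * j) z"

definition odd_term ::
    "complex list \<Rightarrow> complex list \<Rightarrow> complex \<Rightarrow> complex \<Rightarrow> complex \<Rightarrow> complex \<Rightarrow>
     complex \<Rightarrow> complex \<Rightarrow> nat \<Rightarrow> complex" where
  "odd_term as bs \<alpha> \<beta> \<gamma> \<eta> xb z j =
     (-1) ^ j * (\<beta> * \<eta> * xb) ^ (2 * j + 1) / (\<Prod>m=0..2 * j + 1. \<alpha> + of_nat m * \<beta> + 1)
       * F_fun as bs \<alpha> \<beta> \<gamma> (2 * j + 1) z"

text \<open>
  Written out, the term of index $n$ of the series $F_N$ carries the denominator
  $\prod_{m\le N} (\alpha + m\beta + 1 + n\gamma)$. When they are all nonzero, they are bounded
  away from zero uniformly in $m$ and $n$ unless the following condition holds; in that case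
  they can come arbitrarily fast close to zero (for Liouville ratios $\gamma/\beta$), and the
  series over $j$ can then diverge.
\<close>

definition small_divisors :: "complex \<Rightarrow> complex \<Rightarrow> complex \<Rightarrow> bool" where
  "small_divisors \<alpha> \<beta> \<gamma> \<longleftrightarrow>
     \<beta> \<noteq> 0 \<and> \<gamma> / \<beta> \<in> \<real> \<and> Re (\<gamma> / \<beta>) < 0 \<and> \<gamma> / \<beta> \<notin> \<rat> \<and> (\<alpha> + 1) / \<beta> \<in> \<real>"

definition antiderivative_on ::
    "(complex \<Rightarrow> complex) \<Rightarrow> (complex \<Rightarrow> complex) \<Rightarrow> complex set \<Rightarrow> bool" where
  "antiderivative_on G f S \<longleftrightarrow> (\<forall>x\<in>S. (G has_field_derivative f x) (at x))"

end

theory Submission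
  imports Defs "HOL-Complex_Analysis.Complex_Analysis"
begin

text \<open>
  Write $D_{m,n} = \alpha + m\beta + 1 + n\gamma$ and let $c_n$ be the coefficients of
  ${}_pF_q(\dots;\lambda\zeta)$ as a power series in $\zeta = x^\gamma$. The quotient of the
  Pochhammer symbols of $u$ and $u+1$ is $u/(u+n)$, so the extra parameters of $F_N$ multiply
  its $n$-th coefficient by $\prod_{m\le N} D_{m,0}/D_{m,n}$. Hence the $N$-th term of the
  claimed series, without its sign and its trigonometric factor, is
  \[ T_N(x) = (\beta\eta)^N x^{\alpha+1+N\beta} \sum_n \frac{c_n}{\prod_{m\le N} D_{m,n}} x^{n\gamma}. \]
  The exponent of the monomial of index $n$ is exactly $D_{N,n}$, so differentiation removes the
  last divisor: $T_0' = x^\alpha\,{}_pF_q$ and $T_{N+1}' = \omega T_N$, where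
  $\omega = \beta\eta x^{\beta-1}$ is the derivative of $\tau = \eta x^\beta$
  (\<open>iterated_primitive_derivative\<close>). This is repeated integration by parts: the
  derivative of the $J$-th partial sum of
  $\sin\tau\sum_j (-1)^j T_{2j} - \cos\tau\sum_j (-1)^j T_{2j+1}$ telescopes to
  $x^\alpha \sin\tau\,{}_pF_q + (-1)^J \omega \sin\tau\, T_{2J+1}$.

  To pass to the limit, $T_N$ has to tend to zero locally uniformly, whereas convergence of the
  series only yields $T_N \to 0$ pointwise. The recursion makes up the difference: on a ball
  around $x_0$ of radius $r$ with $r \sup|\omega| \le 1/2$, the mean value inequality gives
  $\sup|T_{N+1}| \le |T_{N+1}(x_0)| + \frac12 \sup|T_N|$, which forces the suprema to zero
  (\<open>successive_primitives_locally_uniformly_null\<close>). This argument covers all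
  parameters for which the series converge, however small the divisors may be.

  It remains to prove convergence when the divisors are not small. The map $x \mapsto x^\gamma$ is
  not constant, so by the maximum modulus principle each of its values lies strictly inside the disc
  of convergence of $\sum c_n \zeta^n$ (\<open>branch_pow_norm_increases\<close>); that settles
  the inner series. For the outer series, $|D_{m,n}|$ has a positive lower bound
  (\<open>lattice_translate_bounded_below\<close>), and for fixed $n$ the numbers
  $D_{m,n}/\beta$ are translates of the integers, only boundedly many of which have modulus
  below a given $K$. So $\prod_{m\le N} |D_{m,n}|$ outgrows every geometric sequence in $N$,
  uniformly in $n$ (\<open>prod_norm_translates_lower_bound\<close>).
\<close>

section \<open>Alternating sums of successive primitives\<close>

text \<open>
  From some index on the perturbation is below $r/4$; the recursion then keeps $M$ within
  $r/2$ of a geometrically decaying bound.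
\<close>

lemma contracting_recursion_tendsto_0:
  fixes M e :: "nat \<Rightarrow> real"
  assumes e: "e \<longlonglongrightarrow> 0" and rec: "\<And>n. M (Suc n) = e n + M n / 2"
  shows "M \<longlonglongrightarrow> 0"
proof (rule LIMSEQ_I)
  fix r :: real assume r: "0 < r"
  then have "\<exists>n0. \<forall>n\<ge>n0. norm (e n - 0) < r / 4"
    by (intro LIMSEQ_D[OF e]) auto
  then obtain n0 where n0: "\<And>n. n \<ge> n0 \<Longrightarrow> \<bar>e n\<bar> < r / 4" by auto
  have bound: "\<bar>M (n0 + k)\<bar> \<le> \<bar>M n0\<bar> * (1/2) ^ k + r / 2" for k
  proof (induction k)
    case 0
    show ?case using r by simp
  next
    case (Suc k)
    have "\<bar>M (n0 + Suc k)\<bar> \<le> \<bar>e (n0 + k)\<bar> + \<bar>M (n0 + k)\<bar> / 2"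
      using rec[of "n0 + k"] by simp
    also have "\<dots> \<le> r / 4 + (\<bar>M n0\<bar> * (1/2) ^ k + r / 2) / 2"
      using n0[of "n0 + k"] Suc by (intro add_mono divide_right_mono) (auto intro: less_imp_le)
    finally show ?case by (simp add: field_simps)
  qed
  have "(\<lambda>k. \<bar>M n0\<bar> * (1/2) ^ k) \<longlonglongrightarrow> 0"
    by (intro tendsto_mult_right_zero LIMSEQ_power_zero) auto
  then obtain k0 where k0: "\<And>k. k \<ge> k0 \<Longrightarrow> norm (\<bar>M n0\<bar> * (1/2) ^ k - 0) < r / 2"
    using LIMSEQ_D[of _ 0 "r / 2"] r by force
  have "norm (M n - 0) < r" if "n \<ge> n0 + k0" for n
  proof -
    have "k0 \<le> n - n0" using that by simp
    with bound[of "n - n0"] k0[of "n - n0"] that show ?thesis by simp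
  qed
  then show "\<exists>no. \<forall>n\<ge>no. norm (M n - 0) < r" by blast
qed

text \<open>
  Each function is a primitive of $\omega$ times its predecessor, so on a ball so small that
  integrating against $\omega$ at most halves the supremum, the suprema obey the recursion of
  the previous lemma, with the values at the centre as perturbation.
\<close>

lemma successive_primitives_locally_uniformly_null:
  fixes T :: "nat \<Rightarrow> complex \<Rightarrow> complex" and \<omega> :: "complex \<Rightarrow> complex"
  assumes S: "open S" "x0 \<in> S"
    and \<omega>: "continuous_on S \<omega>" and T0: "continuous_on S (T 0)"
    and deriv: "\<And>N x. x \<in> S \<Longrightarrow> (T (Suc N) has_field_derivative \<omega> x * T N x) (at x)"
    and null: "(\<lambda>N. T N x0) \<longlonglongrightarrow> 0"
  obtains r where "r > 0" "cball x0 r \<subseteq> S" "uniform_limit (cball x0 r) T (\<lambda>_. 0) sequentially"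
proof -
  obtain R where R: "R > 0" "cball x0 R \<subseteq> S"
    using S open_contains_cball by blast
  have "continuous_on (cball x0 R) \<omega>" "continuous_on (cball x0 R) (T 0)"
    using R \<omega> T0 continuous_on_subset by auto
  then have "bounded (\<omega> ` cball x0 R)" "bounded (T 0 ` cball x0 R)"
    by (auto intro!: compact_imp_bounded compact_continuous_image)
  then obtain B C where B: "B > 0" "\<And>x. x \<in> cball x0 R \<Longrightarrow> norm (\<omega> x) \<le> B"
    and C: "\<And>x. x \<in> cball x0 R \<Longrightarrow> norm (T 0 x) \<le> C"
    unfolding bounded_pos by blast
  define r where "r = min R (1 / (2 * B))"
  have r: "r > 0" "r \<le> R" "B * r \<le> 1 / 2"
    using R B by (auto simp: r_def min_def field_simps)
  define M where "M = rec_nat C (\<lambda>N m. norm (T (Suc N) x0) + m / 2)"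
  have M_Suc: "M (Suc N) = norm (T (Suc N) x0) + M N / 2" for N by (simp add: M_def)
  have "M \<longlonglongrightarrow> 0"
  proof (rule contracting_recursion_tendsto_0[where M = M and e = "\<lambda>N. norm (T (Suc N) x0)", OF _ M_Suc])
    show "(\<lambda>N. norm (T (Suc N) x0)) \<longlonglongrightarrow> 0"
      by (intro tendsto_norm_zero LIMSEQ_Suc[OF null])
  qed
  have bound: "norm (T N x) \<le> M N" if "x \<in> cball x0 r" for N x
    using that
  proof (induction N arbitrary: x)
    case 0
    then show ?case using C r by (auto simp: M_def)
  next
    case (Suc N)
    have sub: "cball x0 r \<subseteq> cball x0 R" using r by auto
    have M_nonneg: "0 \<le> M N" by (rule order_trans[OF norm_ge_zero Suc.IH[OF Suc.prems]])
    have "norm (T (Suc N) x - T (Suc N) x0) \<le> (B * M N) * norm (x - x0)"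
    proof (rule field_differentiable_bound)
      show "convex (cball x0 r)" by simp
      show "(T (Suc N) has_field_derivative \<omega> z * T N z) (at z within cball x0 r)"
        if "z \<in> cball x0 r" for z
        using that sub R by (intro has_field_derivative_at_within[OF deriv]) auto
      show "norm (\<omega> z * T N z) \<le> B * M N" if "z \<in> cball x0 r" for z
      proof -
        have "z \<in> cball x0 R" using that sub by (rule rev_subsetD)
        then show ?thesis
          unfolding norm_mult using Suc.IH[OF that] B by (intro mult_mono) (auto intro: less_imp_le)
      qed
    qed (use Suc.prems r in auto)
    also have "\<dots> \<le> (B * M N) * r"
      using Suc.prems B M_nonneg by (intro mult_left_mono) (auto simp: dist_norm norm_minus_commute)
    also have "\<dots> = (B * r) * M N" by simp
    also have "\<dots> \<le> 1 / 2 * M N"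
      using r M_nonneg by (intro mult_right_mono)
    finally show ?case
      unfolding M_Suc using norm_triangle_sub[of "T (Suc N) x" "T (Suc N) x0"] by linarith
  qed
  have "uniform_limit (cball x0 r) T (\<lambda>_. 0) sequentially"
  proof (rule uniform_limitI)
    fix e :: real assume "e > 0"
    then have "\<forall>\<^sub>F n in sequentially. M n < e"
      by (rule order_tendstoD(2)[OF \<open>M \<longlonglongrightarrow> 0\<close>])
    then show "\<forall>\<^sub>F n in sequentially. \<forall>x\<in>cball x0 r. dist (T n x) 0 < e"
      by eventually_elim (auto intro: le_less_trans[OF bound])
  qed
  moreover have "cball x0 r \<subseteq> S" using r R by auto
  ultimately show ?thesis using that r by blast
qed

text \<open>
  Integration by parts, term by term: the derivatives of $\sin\tau$ and $\cos\tau$ cancel the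
  derivatives of the terms of the other sum, and only the last odd term is left over.
\<close>

lemma alternating_primitives_partial_sum_derivative:
  fixes T :: "nat \<Rightarrow> complex \<Rightarrow> complex"
  assumes \<tau>: "(\<tau> has_field_derivative \<omega>) (at x)"
    and T0: "(T 0 has_field_derivative h) (at x)"
    and deriv: "\<And>N. (T (Suc N) has_field_derivative \<omega> * T N x) (at x)"
  shows "((\<lambda>x. sin (\<tau> x) * (\<Sum>j\<le>J. (-1) ^ j * T (2 * j) x)
             - cos (\<tau> x) * (\<Sum>j\<le>J. (-1) ^ j * T (2 * j + 1) x))
          has_field_derivative h * sin (\<tau> x) + (-1) ^ J * sin (\<tau> x) * \<omega> * T (2 * J + 1) x) (at x)"
proof -
  have step: "((\<lambda>x. sin (\<tau> x) * (c * A x) - cos (\<tau> x) * (c * B x))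
          has_field_derivative c * sin (\<tau> x) * \<omega> * B x + c * (sin (\<tau> x) * A')) (at x)"
    if "(A has_field_derivative A') (at x)" "(B has_field_derivative \<omega> * A x) (at x)" for A B A' c
    by (rule derivative_eq_intros \<tau> that refl)+ (simp add: algebra_simps)
  show ?thesis
  proof (induction J)
    case 0
    show ?case
      using step[of "T 0" h "T 1" 1] T0 deriv[of 0] by (simp add: algebra_simps)
  next
    case (Suc J)
    have 1: "(T (2 * Suc J) has_field_derivative \<omega> * T (2 * J + 1) x) (at x)"
      and 2: "(T (2 * Suc J + 1) has_field_derivative \<omega> * T (2 * Suc J) x) (at x)"
      using deriv[of "2 * J + 1"] deriv[of "2 * Suc J"] by simp_all
    have *: "s * (a + p) - k * (b + q) = (s * a - k * b) + (s * p - k * q)" for s a p k b q :: complex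
      by (simp add: algebra_simps)
    show ?case
      unfolding sum.atMost_Suc *
      by (rule DERIV_cong[OF DERIV_add[OF Suc step[OF 1 2]]]) simp
  qed
qed

text \<open>
  Pointwise convergence of the two series suffices: it makes their terms tend to zero, the
  preceding lemmas turn this into uniform convergence of the derivatives of the partial sums on
  a ball, and then limit and derivative may be exchanged.
\<close>

lemma alternating_primitives_derivative:
  fixes T :: "nat \<Rightarrow> complex \<Rightarrow> complex"
  assumes S: "open S" "x \<in> S"
    and \<tau>: "\<And>x. x \<in> S \<Longrightarrow> (\<tau> has_field_derivative \<omega> x) (at x)"
    and \<omega>: "continuous_on S \<omega>"
    and T0: "\<And>x. x \<in> S \<Longrightarrow> (T 0 has_field_derivative h x) (at x)"
    and deriv: "\<And>N x. x \<in> S \<Longrightarrow> (T (Suc N) has_field_derivative \<omega> x * T N x) (at x)"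
    and even: "\<And>x. x \<in> S \<Longrightarrow> summable (\<lambda>j. (-1) ^ j * T (2 * j) x)"
    and odd: "\<And>x. x \<in> S \<Longrightarrow> summable (\<lambda>j. (-1) ^ j * T (2 * j + 1) x)"
  shows "((\<lambda>x. sin (\<tau> x) * (\<Sum>j. (-1) ^ j * T (2 * j) x)
             - cos (\<tau> x) * (\<Sum>j. (-1) ^ j * T (2 * j + 1) x))
          has_field_derivative h x * sin (\<tau> x)) (at x)"
proof -
  have sign: "f \<longlonglongrightarrow> 0" if "summable (\<lambda>j. (-1) ^ j * f j)" for f :: "nat \<Rightarrow> complex"
    using tendsto_norm_zero[OF summable_LIMSEQ_zero[OF that]]
    by (subst tendsto_norm_zero_iff[symmetric]) (simp add: norm_mult norm_power)
  have "(\<lambda>j. T (2 * j) x) \<longlonglongrightarrow> 0" "(\<lambda>j. T (2 * j + 1) x) \<longlonglongrightarrow> 0"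
    using sign[OF even[OF S(2)]] sign[OF odd[OF S(2)]] .
  then have null: "(\<lambda>N. T N x) \<longlonglongrightarrow> 0"
  proof (intro LIMSEQ_I)
    fix e :: real assume "e > 0"
    with \<open>(\<lambda>j. T (2 * j) x) \<longlonglongrightarrow> 0\<close> \<open>(\<lambda>j. T (2 * j + 1) x) \<longlonglongrightarrow> 0\<close>
    obtain k l where kl: "\<And>j. j \<ge> k \<Longrightarrow> norm (T (2 * j) x) < e" "\<And>j. j \<ge> l \<Longrightarrow> norm (T (2 * j + 1) x) < e"
      by (metis LIMSEQ_D diff_zero)
    have "norm (T N x - 0) < e" if "N \<ge> 2 * k + 2 * l + 1" for N
      by (cases "even N") (use kl[of "N div 2"] that in auto)
    then show "\<exists>N0. \<forall>N\<ge>N0. norm (T N x - 0) < e" by blast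
  qed
  have contT0: "continuous_on S (T 0)"
    using T0 by (meson DERIV_isCont continuous_at_imp_continuous_on)
  obtain r where r: "r > 0" "cball x r \<subseteq> S" and unif: "uniform_limit (cball x r) T (\<lambda>_. 0) sequentially"
    using successive_primitives_locally_uniformly_null[OF S \<omega> contT0 deriv null] by blast
  define P where "P J x = sin (\<tau> x) * (\<Sum>j\<le>J. (-1) ^ j * T (2 * j) x)
             - cos (\<tau> x) * (\<Sum>j\<le>J. (-1) ^ j * T (2 * j + 1) x)" for J x
  define P' where "P' J x = h x * sin (\<tau> x) + (-1) ^ J * sin (\<tau> x) * \<omega> x * T (2 * J + 1) x" for J x
  have cont: "continuous_on (cball x r) (\<lambda>x. sin (\<tau> x) * \<omega> x)"
    using r \<omega> \<tau> by (intro continuous_intros)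
      (auto intro: continuous_on_subset DERIV_isCont continuous_at_imp_continuous_on)
  then have "bounded ((\<lambda>x. sin (\<tau> x) * \<omega> x) ` cball x r)"
    by (auto intro!: compact_imp_bounded compact_continuous_image)
  then obtain B where B: "B > 0" "\<And>y. y \<in> cball x r \<Longrightarrow> norm (sin (\<tau> y) * \<omega> y) \<le> B"
    unfolding bounded_pos by blast
  have "\<exists>g. \<forall>y\<in>cball x r. (\<lambda>J. P J y) \<longlonglongrightarrow> g y \<and>
          (g has_field_derivative h y * sin (\<tau> y)) (at y within cball x r)"
  proof (rule has_complex_derivative_sequence)
    show "convex (cball x r)" by simp
    show "(P J has_field_derivative P' J y) (at y within cball x r)" if "y \<in> cball x r" for J y
    proof -
      have y: "y \<in> S" using that r by auto
      show ?thesis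
        unfolding P_def P'_def
        by (rule has_field_derivative_at_within,
            rule alternating_primitives_partial_sum_derivative[OF \<tau>[OF y] T0[OF y] deriv[OF y]])
    qed
    show "\<exists>N. \<forall>J y. J \<ge> N \<longrightarrow> y \<in> cball x r \<longrightarrow> norm (P' J y - h y * sin (\<tau> y)) \<le> e" if "e > 0" for e
    proof -
      have "\<forall>\<^sub>F N in sequentially. \<forall>y\<in>cball x r. dist (T N y) 0 < e / B"
        using unif B that by (intro uniform_limitD) auto
      then obtain N where N: "\<And>n y. n \<ge> N \<Longrightarrow> y \<in> cball x r \<Longrightarrow> norm (T n y) < e / B"
        unfolding eventually_sequentially dist_norm diff_zero by blast
      have "norm (P' J y - h y * sin (\<tau> y)) \<le> e" if "J \<ge> N" "y \<in> cball x r" for J y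
      proof -
        have "norm (P' J y - h y * sin (\<tau> y)) = norm (sin (\<tau> y) * \<omega> y) * norm (T (2 * J + 1) y)"
          by (simp add: P'_def norm_mult norm_power)
        also have "\<dots> \<le> B * (e / B)"
          using B(1) B(2)[OF that(2)] N[OF _ that(2), of "2 * J + 1"] that(1)
          by (intro mult_mono) (auto intro: less_imp_le)
        finally show ?thesis using B by simp
      qed
      then show ?thesis by blast
    qed
    have "(\<lambda>J. P J x) \<longlonglongrightarrow> sin (\<tau> x) * (\<Sum>j. (-1) ^ j * T (2 * j) x)
             - cos (\<tau> x) * (\<Sum>j. (-1) ^ j * T (2 * j + 1) x)"
      unfolding P_def by (intro tendsto_intros summable_LIMSEQ' even odd S)
    moreover have "x \<in> cball x r" using r by simp
    ultimately show "\<exists>y l. y \<in> cball x r \<and> (\<lambda>J. P J y) \<longlonglongrightarrow> l" by blast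
  qed
  then obtain g where g: "\<And>y. y \<in> cball x r \<Longrightarrow> (\<lambda>J. P J y) \<longlonglongrightarrow> g y"
     "\<And>y. y \<in> cball x r \<Longrightarrow> (g has_field_derivative h y * sin (\<tau> y)) (at y within cball x r)"
    by blast
  have "(g has_field_derivative h x * sin (\<tau> x)) (at x)"
    using g(2)[of x] r at_within_interior[of x "cball x r"] by simp
  then show ?thesis
  proof (rule has_field_derivative_transform_within_open[where S = "ball x r"])
    fix y assume "y \<in> ball x r"
    then have y: "y \<in> cball x r" "y \<in> S" using r by auto
    have "(\<lambda>J. P J y) \<longlonglongrightarrow> sin (\<tau> y) * (\<Sum>j. (-1) ^ j * T (2 * j) y)
             - cos (\<tau> y) * (\<Sum>j. (-1) ^ j * T (2 * j + 1) y)"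
      unfolding P_def by (intro tendsto_intros summable_LIMSEQ' even odd y)
    with g(1)[OF y(1)] show "g y = sin (\<tau> y) * (\<Sum>j. (-1) ^ j * T (2 * j) y)
             - cos (\<tau> y) * (\<Sum>j. (-1) ^ j * T (2 * j + 1) y)"
      by (rule LIMSEQ_unique)
  qed (use r in auto)
qed

section \<open>Lower bounds for the divisors\<close>

text \<open>
  As a function of \<open>n\<close> for fixed \<open>m\<close>, the divisor runs through the exponents of $x$
  in $x^{\alpha+1+m\beta}$ times a power series in $x^\gamma$.
\<close>

definition divisor :: "complex \<Rightarrow> complex \<Rightarrow> complex \<Rightarrow> nat \<Rightarrow> nat \<Rightarrow> complex" where
  "divisor \<alpha> \<beta> \<gamma> m n = \<alpha> + of_nat m * \<beta> + 1 + of_nat n * \<gamma>"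

lemma finite_int_translates_near_0:
  fixes s :: complex and r :: real
  shows "finite {k::int. norm (s + of_int k) < r}"
proof (rule finite_subset)
  show "{k. norm (s + of_int k) < r} \<subseteq> {\<lfloor>- Re s - r\<rfloor>..\<lceil>- Re s + r\<rceil>}"
  proof safe
    fix k :: int assume "norm (s + of_int k) < r"
    then have "\<bar>Re s + of_int k\<bar> < r"
      using abs_Re_le_cmod[of "s + of_int k"] by simp
    then show "k \<in> {\<lfloor>- Re s - r\<rfloor>..\<lceil>- Re s + r\<rceil>}"
      by (simp add: floor_le_iff le_ceiling_iff abs_less_iff)
  qed
qed simp

text \<open>
  The excluded case, a negative irrational \<open>r\<close> with real \<open>s\<close>, is the one in which
  the numbers $s + m + nr$ are dense in the real line. If \<open>r\<close> is not real or is positive,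
  only finitely many pairs give a value in the unit disc; if \<open>r\<close> is rational, many pairs may,
  but they share finitely many values; if \<open>r\<close> is real and \<open>s\<close> is not, the imaginary
  part of \<open>s\<close> is a lower bound.
\<close>

lemma lattice_translate_bounded_below:
  fixes s r :: complex
  assumes nz: "\<And>m n. s + of_nat m + of_nat n * r \<noteq> 0"
    and r: "r \<noteq> 0"
    and good: "r \<notin> \<real> \<or> Re r \<ge> 0 \<or> r \<in> \<rat> \<or> s \<notin> \<real>"
  obtains \<delta> where "\<delta> > 0" "\<And>m n. norm (s + of_nat m + of_nat n * r) \<ge> \<delta>"
proof -
  define V where "V = range (\<lambda>(m, n). s + of_nat m + of_nat n * r)"
  note bound = that
  have fin: thesis if "finite (V \<inter> ball 0 1)"
  proof -
    obtain d where d: "d > 0" "\<And>v. v \<in> V \<inter> ball 0 1 \<Longrightarrow> v \<noteq> 0 \<Longrightarrow> d \<le> dist 0 v"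
      using finite_set_avoid[OF \<open>finite (V \<inter> ball 0 1)\<close>] by metis
    have "min d 1 \<le> norm (s + of_nat m + of_nat n * r)" for m n
    proof -
      have "s + of_nat m + of_nat n * r \<in> V" by (auto simp: V_def intro!: image_eqI[of _ _ "(m, n)"])
      then show ?thesis using d(2)[of "s + of_nat m + of_nat n * r"] nz[of m n]
        by (cases "norm (s + of_nat m + of_nat n * r) < 1") auto
    qed
    then show ?thesis using d(1) by (intro bound[of "min d 1"]) auto
  qed
  have box: thesis if "\<And>m n. norm (s + of_nat m + of_nat n * r) < 1 \<Longrightarrow> real m \<le> M \<and> real n \<le> N" for M N
  proof (rule fin)
    have "V \<inter> ball 0 1 \<subseteq> (\<lambda>(m, n). s + of_nat m + of_nat n * r) ` ({..nat \<lfloor>M\<rfloor>} \<times> {..nat \<lfloor>N\<rfloor>})"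
    proof
      fix v assume v: "v \<in> V \<inter> ball 0 1"
      then obtain m n where mn: "v = s + of_nat m + of_nat n * r" by (auto simp: V_def)
      with v that[of m n] have "m \<le> nat \<lfloor>M\<rfloor>" "n \<le> nat \<lfloor>N\<rfloor>" by (auto simp: le_nat_floor)
      with mn show "v \<in> (\<lambda>(m, n). s + of_nat m + of_nat n * r) ` ({..nat \<lfloor>M\<rfloor>} \<times> {..nat \<lfloor>N\<rfloor>})"
        by (intro image_eqI[of _ _ "(m, n)"]) auto
    qed
    then show "finite (V \<inter> ball 0 1)" by (rule finite_subset) auto
  qed
  consider "Im r \<noteq> 0" | "Im r = 0" "Re r \<ge> 0" | "r \<in> \<rat>" | "Im r = 0" "Im s \<noteq> 0"
    using good by (auto simp: complex_is_Real_iff)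
  then show ?thesis
  proof cases
    case 1
    show ?thesis
    proof (rule box)
      fix m n assume "norm (s + of_nat m + of_nat n * r) < 1"
      then have re: "\<bar>Re s + real m + real n * Re r\<bar> < 1" and im: "\<bar>Im s + real n * Im r\<bar> < 1"
        using abs_Re_le_cmod[of "s + of_nat m + of_nat n * r"] abs_Im_le_cmod[of "s + of_nat m + of_nat n * r"]
        by auto
      have "real n * \<bar>Im r\<bar> = \<bar>real n * Im r\<bar>" by (simp add: abs_mult)
      also have "\<dots> \<le> 1 + \<bar>Im s\<bar>" using im by linarith
      finally have n: "real n \<le> (1 + \<bar>Im s\<bar>) / \<bar>Im r\<bar>" using 1 by (simp add: field_simps)
      have "real m \<le> 1 + \<bar>Re s\<bar> + \<bar>real n * Re r\<bar>" using re by linarith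
      also have "\<bar>real n * Re r\<bar> \<le> (1 + \<bar>Im s\<bar>) / \<bar>Im r\<bar> * \<bar>Re r\<bar>"
        unfolding abs_mult using n by (intro mult_right_mono) auto
      finally show "real m \<le> 1 + \<bar>Re s\<bar> + (1 + \<bar>Im s\<bar>) / \<bar>Im r\<bar> * \<bar>Re r\<bar> \<and> real n \<le> (1 + \<bar>Im s\<bar>) / \<bar>Im r\<bar>"
        using n by simp
    qed
  next
    case 2
    then have pos: "Re r > 0" using r by (auto simp: complex_eq_iff less_le)
    show ?thesis
    proof (rule box)
      fix m n assume "norm (s + of_nat m + of_nat n * r) < 1"
      then have re: "\<bar>Re s + real m + real n * Re r\<bar> < 1"
        using abs_Re_le_cmod[of "s + of_nat m + of_nat n * r"] by auto
      moreover have nn: "0 \<le> real n * Re r" using pos by simp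
      ultimately have "real m \<le> 1 + \<bar>Re s\<bar>" "real n * Re r \<le> 1 + \<bar>Re s\<bar>" by linarith+
      then show "real m \<le> 1 + \<bar>Re s\<bar> \<and> real n \<le> (1 + \<bar>Re s\<bar>) / Re r"
        using pos by (simp add: field_simps)
    qed
  next
    case 3
    then obtain q where "r = of_rat q" by (auto elim: Rats_cases)
    moreover obtain a b where q: "q = Rat.Fract a b" "b > 0" by (cases q)
    ultimately have r_eq: "r = of_int a / of_int b"
      by (simp add: of_rat_rat)
    have scaled: "of_int b * (s + of_nat m + of_nat n * r) = of_int b * s + of_int (b * int m + int n * a)" for m n
      using q r_eq by (simp add: algebra_simps)
    \<comment> \<open>Clearing the denominator of \<open>r\<close> puts all values into one translate of the integers.\<close>
    let ?K = "{k::int. norm (of_int b * s + of_int k) < of_int b}"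
    show ?thesis
    proof (rule fin)
      have "V \<inter> ball 0 1 \<subseteq> (\<lambda>k. (of_int b * s + of_int k) / of_int b) ` ?K"
      proof safe
        fix v assume "v \<in> V" "v \<in> ball 0 1"
        then obtain m n where v: "v = s + of_nat m + of_nat n * r" "norm v < 1"
          by (auto simp: V_def)
        have "norm (of_int b * v) < of_int b" using v q by (simp add: norm_mult)
        then have "b * int m + int n * a \<in> ?K" using scaled[of m n] v by simp
        moreover have "v = (of_int b * s + of_int (b * int m + int n * a)) / of_int b"
          unfolding scaled[symmetric] v using q by simp
        ultimately show "v \<in> (\<lambda>k. (of_int b * s + of_int k) / of_int b) ` ?K" by blast
      qed
      then show "finite (V \<inter> ball 0 1)"
        by (rule finite_subset) (intro finite_imageI finite_int_translates_near_0)
    qed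
  next
    case 4
    show ?thesis
    proof (rule that[of "\<bar>Im s\<bar>"])
      show "\<bar>Im s\<bar> \<le> norm (s + of_nat m + of_nat n * r)" for m n
        using abs_Im_le_cmod[of "s + of_nat m + of_nat n * r"] 4 by simp
    qed (use 4 in auto)
  qed
qed

lemma card_nat_translates_near_0:
  fixes w :: complex and K :: nat
  shows "card {m\<in>A. norm (w + of_nat m) < real K} \<le> 2 * K + 1"
proof -
  let ?I = "{\<lceil>- Re w - K\<rceil>..\<lfloor>- Re w + K\<rfloor>}"
  have "int ` {m\<in>A. norm (w + of_nat m) < real K} \<subseteq> ?I"
  proof safe
    fix m assume "norm (w + of_nat m) < real K"
    then have "\<bar>Re w + real m\<bar> < K"
      using abs_Re_le_cmod[of "w + of_nat m"] by simp
    then show "int m \<in> ?I" by (auto simp: abs_less_iff ceiling_le_iff le_floor_iff)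
  qed
  then have "card (int ` {m\<in>A. norm (w + of_nat m) < real K}) \<le> card ?I"
    by (intro card_mono) auto
  also have "card ?I \<le> 2 * K + 1" by simp linarith
  finally show ?thesis by (simp add: card_image)
qed

text \<open>
  Every factor is at least $K$, except for at most $2K+1$ factors that are still at least
  $\delta = K\cdot\delta/K$. The point is that the constant depends on neither \<open>w\<close>
  nor \<open>N\<close>, so that the growth rate $K$ can be chosen at will.
\<close>

lemma prod_norm_translates_lower_bound:
  fixes w :: complex and K N :: nat
  assumes \<delta>: "0 < \<delta>" "\<delta> \<le> real K" and low: "\<And>m. \<delta> \<le> norm (w + of_nat m)"
  shows "(\<delta> / K) ^ (2 * K + 1) * real K ^ Suc N \<le> (\<Prod>m\<le>N. norm (w + of_nat m))"
proof -
  define near where "near = {m\<in>{..N}. norm (w + of_nat m) < real K}"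
  have K: "real K > 0" using \<delta> by linarith
  have "(\<delta> / K) ^ (2 * K + 1) * real K ^ Suc N \<le> (\<delta> / K) ^ card near * real K ^ Suc N"
    using card_nat_translates_near_0[of "{..N}" w K] \<delta> K unfolding near_def
    by (intro mult_right_mono power_decreasing) (auto simp: field_simps)
  also have "(\<delta> / K) ^ card near = (\<Prod>m\<le>N. if m \<in> near then \<delta> / K else 1)"
    by (subst prod.If_cases) (auto simp: near_def Int_def)
  also have "\<dots> * real K ^ Suc N = (\<Prod>m\<le>N. (if m \<in> near then \<delta> / K else 1) * real K)"
    by (simp add: prod.distrib)
  also have "\<dots> \<le> (\<Prod>m\<le>N. norm (w + of_nat m))"
    using low K \<delta> by (intro prod_mono) (auto simp: near_def)
  finally show ?thesis .
qed

section \<open>Powers along a branch of the logarithm\<close>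

lemma branch_derivative:
  assumes "open S" "L holomorphic_on S" "\<And>x. x \<in> S \<Longrightarrow> exp (L x) = x" "x \<in> S"
  shows "(L has_field_derivative 1 / x) (at x)"
proof -
  have L: "(L has_field_derivative deriv L x) (at x)"
    using assms by (intro holomorphic_derivI)
  have "((\<lambda>x. exp (L x)) has_field_derivative exp (L x) * deriv L x) (at x)"
    by (rule derivative_eq_intros L refl)+
  moreover have "((\<lambda>x. exp (L x)) has_field_derivative 1) (at x)"
    by (rule has_field_derivative_transform_within_open[OF DERIV_ident]) (use assms in auto)
  ultimately have "x * deriv L x = 1"
    using assms DERIV_unique by metis
  then have "deriv L x = 1 / x"
    by (cases "x = 0") (auto simp: field_simps)
  with L show ?thesis by simp
qed

lemma branch_pow_derivative:
  assumes "(L has_field_derivative 1 / x) (at x)"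
  shows "((\<lambda>x. branch_pow L x a) has_field_derivative a * branch_pow L x a / x) (at x)"
  unfolding branch_pow_def by (rule derivative_eq_intros assms refl)+ simp

lemma branch_pow_add: "branch_pow L x (a + b) = branch_pow L x a * branch_pow L x b"
  by (simp add: branch_pow_def algebra_simps exp_add)

lemma branch_pow_1: "exp (L x) = x \<Longrightarrow> branch_pow L x 1 = x"
  by (simp add: branch_pow_def)

lemma branch_pow_of_nat_mult: "branch_pow L x (of_nat n * a) = branch_pow L x a ^ n"
  by (simp add: branch_pow_def exp_of_nat_mult[symmetric] mult.assoc)

text \<open>
  Termwise differentiation: the monomial $x^{A+n\gamma}$ is multiplied by its exponent and
  divided by $x$. The point \<open>K\<close> certifies that the argument of the power series lies inside
  its disc of convergence.
\<close>

lemma branch_pow_series_derivative: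
  assumes L: "(L has_field_derivative 1 / x) (at x)"
    and g: "summable (\<lambda>n. g n * K ^ n)" and K: "norm (branch_pow L x \<gamma>) < norm K"
  shows "((\<lambda>x. branch_pow L x A * (\<Sum>n. g n * branch_pow L x \<gamma> ^ n)) has_field_derivative
           branch_pow L x A / x * (\<Sum>n. (A + of_nat n * \<gamma>) * (g n * branch_pow L x \<gamma> ^ n))) (at x)"
proof -
  define \<zeta> where "\<zeta> = branch_pow L x \<gamma>"
  define D where "D = (\<Sum>n. diffs g n * \<zeta> ^ n)"
  have K: "norm \<zeta> < norm K" using K by (simp add: \<zeta>_def)
  have D: "((\<lambda>z. \<Sum>n. g n * z ^ n) has_field_derivative D) (at \<zeta>)"
    unfolding D_def by (rule termdiffs_strong[OF g K])
  have "summable (\<lambda>n. diffs g n * \<zeta> ^ n)"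
  proof (rule termdiff_converges[OF K])
    show "summable (\<lambda>n. g n * z ^ n)" if "norm z < norm K" for z
      by (rule powser_inside[OF g that])
  qed
  then have "(\<lambda>n. of_nat n * g n * \<zeta> ^ (n - Suc 0)) sums D"
    unfolding D_def by (rule diffs_equiv)
  then have "(\<lambda>n. of_nat n * g n * \<zeta> ^ (n - Suc 0) * \<zeta>) sums (D * \<zeta>)"
    by (rule sums_mult2)
  also have "(\<lambda>n. of_nat n * g n * \<zeta> ^ (n - Suc 0) * \<zeta>) = (\<lambda>n. of_nat n * (g n * \<zeta> ^ n))"
  proof
    show "of_nat n * g n * \<zeta> ^ (n - Suc 0) * \<zeta> = of_nat n * (g n * \<zeta> ^ n)" for n
      by (cases n) simp_all
  qed
  finally have "(\<lambda>n. A * (g n * \<zeta> ^ n) + \<gamma> * (of_nat n * (g n * \<zeta> ^ n)))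
      sums (A * (\<Sum>n. g n * \<zeta> ^ n) + \<gamma> * (D * \<zeta>))"
    by (intro sums_add sums_mult summable_sums powser_inside[OF g K])
  then have sum: "(\<Sum>n. (A + of_nat n * \<gamma>) * (g n * \<zeta> ^ n)) = A * (\<Sum>n. g n * \<zeta> ^ n) + \<gamma> * (D * \<zeta>)"
    by (simp add: sums_iff algebra_simps)
  have "((\<lambda>x. \<Sum>n. g n * branch_pow L x \<gamma> ^ n) has_field_derivative D * (\<gamma> * \<zeta> / x)) (at x)"
    using D branch_pow_derivative[OF L, of \<gamma>] unfolding \<zeta>_def by (rule DERIV_chain2)
  from DERIV_mult[OF branch_pow_derivative[OF L, of A] this]
  show ?thesis
    unfolding \<zeta>_def[symmetric] sum
    by (rule DERIV_cong) (simp add: algebra_simps add_divide_distrib flip: \<zeta>_def)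
qed

text \<open>
  Convergence of a power series at all values of $x^\gamma$ thus implies absolute convergence at
  each of them. Working with $x^\gamma$ instead of $\lambda x^\gamma$, the factor $\lambda^n$
  being part of the coefficient, avoids a separate treatment of $\lambda = 0$.
\<close>

lemma branch_pow_norm_increases:
  assumes S: "open S" "connected S"
    and L: "L holomorphic_on S" "\<And>x. x \<in> S \<Longrightarrow> exp (L x) = x"
    and "\<gamma> \<noteq> 0" "x \<in> S"
  obtains y where "y \<in> S" "norm (branch_pow L x \<gamma>) < norm (branch_pow L y \<gamma>)"
proof (rule ccontr)
  assume "\<not> thesis"
  then have max: "\<And>y. y \<in> S \<Longrightarrow> norm (branch_pow L y \<gamma>) \<le> norm (branch_pow L x \<gamma>)"
    using that by force
  have "(\<lambda>x. branch_pow L x \<gamma>) holomorphic_on S"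
    unfolding branch_pow_def by (intro holomorphic_intros L)
  from maximum_modulus_principle[OF this S S(1) subset_refl \<open>x \<in> S\<close> max]
  obtain c where c: "\<And>y. y \<in> S \<Longrightarrow> branch_pow L y \<gamma> = c"
    unfolding constant_on_def by blast
  have "((\<lambda>x. branch_pow L x \<gamma>) has_field_derivative 0) (at x)"
    by (rule has_field_derivative_transform_within_open[OF DERIV_const[of c] S(1) \<open>x \<in> S\<close>]) (simp add: c)
  then have "\<gamma> * branch_pow L x \<gamma> / x = 0"
    using branch_pow_derivative[OF branch_derivative[OF S(1) L \<open>x \<in> S\<close>]] DERIV_unique by blast
  moreover have "x \<noteq> 0" using L(2)[OF \<open>x \<in> S\<close>] by auto
  ultimately show False using \<open>\<gamma> \<noteq> 0\<close> by (simp add: branch_pow_def)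
qed

section \<open>Power series divided by the products of divisors\<close>

definition divided_coeff ::
    "complex \<Rightarrow> complex \<Rightarrow> complex \<Rightarrow> (nat \<Rightarrow> complex) \<Rightarrow> nat \<Rightarrow> nat \<Rightarrow> complex" where
  "divided_coeff \<alpha> \<beta> \<gamma> c N n = c n / (\<Prod>m\<le>N. divisor \<alpha> \<beta> \<gamma> m n)"

text \<open>For fixed \<open>N\<close> the reciprocals of the divisors tend to zero as \<open>n\<close> grows, hence are bounded.\<close>

lemma divided_coeff_summable:
  assumes "\<gamma> \<noteq> 0" and c: "summable (\<lambda>n. norm (c n * z ^ n))"
  shows "summable (\<lambda>n. norm (divided_coeff \<alpha> \<beta> \<gamma> c N n * z ^ n))"
proof -
  have "(\<lambda>n. inverse (divisor \<alpha> \<beta> \<gamma> m n)) \<longlonglongrightarrow> 0" for m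
    unfolding divisor_def
    by (intro tendsto_inverse_0[THEN filterlim_compose] tendsto_add_filterlim_at_infinity[OF tendsto_const]
          tendsto_mult_filterlim_at_infinity[OF tendsto_const] assms tendsto_of_nat
        | subst mult.commute)+
  then have "(\<lambda>n. \<Prod>m\<le>N. inverse (divisor \<alpha> \<beta> \<gamma> m n)) \<longlonglongrightarrow> (\<Prod>m\<le>N. 0)"
    by (intro tendsto_prod)
  then have "Bseq (\<lambda>n. \<Prod>m\<le>N. inverse (divisor \<alpha> \<beta> \<gamma> m n))"
    by (intro convergent_imp_Bseq convergentI)
  then obtain B where B: "\<And>n. norm (\<Prod>m\<le>N. inverse (divisor \<alpha> \<beta> \<gamma> m n)) \<le> B"
    unfolding Bseq_def by blast
  have "norm (norm (divided_coeff \<alpha> \<beta> \<gamma> c N n * z ^ n)) \<le> B * norm (c n * z ^ n)" for n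
  proof -
    have "divided_coeff \<alpha> \<beta> \<gamma> c N n * z ^ n = (\<Prod>m\<le>N. inverse (divisor \<alpha> \<beta> \<gamma> m n)) * (c n * z ^ n)"
      by (simp add: divided_coeff_def divide_inverse o_def flip: prod_inversef)
    then show ?thesis
      using mult_right_mono[OF B[of n] norm_ge_zero[of "c n * z ^ n"]] by (simp only: norm_mult real_norm_def abs_norm_cancel abs_mult)
  qed
  then show ?thesis
    by (intro summable_comparison_test'[OF summable_mult[OF c, of B]])
qed

text \<open>
  Choosing $K > 2|y|/|\beta|$ in the lower bound for the products makes the terms decay at
  least like a geometric sequence. For $\beta = 0$ the divisors do not depend on \<open>m\<close> and the
  bound fails, but then $y = \beta\eta x^\beta$ vanishes and only the term $N = 0$ is left.
\<close>

lemma divided_series_summable: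
  assumes \<gamma>: "\<gamma> \<noteq> 0" and nz: "\<And>m n. divisor \<alpha> \<beta> \<gamma> m n \<noteq> 0"
    and no_small: "\<not> small_divisors \<alpha> \<beta> \<gamma>"
    and c: "summable (\<lambda>n. norm (c n * z ^ n))" and y: "\<beta> = 0 \<Longrightarrow> y = 0"
  shows "summable (\<lambda>N. norm (y ^ N * (\<Sum>n. divided_coeff \<alpha> \<beta> \<gamma> c N n * z ^ n)))"
proof (cases "\<beta> = 0")
  case True
  then show ?thesis by (intro summable_finite[of "{0}"]) (auto simp: y)
next
  case False
  define s where "s = (\<alpha> + 1) / \<beta>"
  define r where "r = \<gamma> / \<beta>"
  have div: "divisor \<alpha> \<beta> \<gamma> m n = \<beta> * (s + of_nat n * r + of_nat m)" for m n
    using False by (simp add: divisor_def s_def r_def field_simps)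
  obtain \<delta> where \<delta>: "\<delta> > 0" "\<And>m n. norm (s + of_nat m + of_nat n * r) \<ge> \<delta>"
  proof (rule lattice_translate_bounded_below)
    show "s + of_nat m + of_nat n * r \<noteq> 0" for m n
      using nz[of m n] unfolding div by (simp add: add_ac)
    show "r \<noteq> 0" using \<gamma> False by (simp add: r_def)
    show "r \<notin> \<real> \<or> Re r \<ge> 0 \<or> r \<in> \<rat> \<or> s \<notin> \<real>"
      using no_small False by (auto simp: small_divisors_def r_def s_def)
  qed blast
  obtain K :: nat where K: "real K > max \<delta> (2 * norm y / norm \<beta>)"
    using reals_Archimedean2 by blast
  define d where "d = norm \<beta> * (real K * (\<delta> / K) ^ (2 * K + 1))"
  define q where "q = norm y / (norm \<beta> * real K)"
  have K0: "real K > 0" and \<delta>K: "\<delta> \<le> real K" using K \<delta> by auto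
  have d0: "d > 0" using K0 \<delta> False by (simp add: d_def)
  have q: "0 \<le> q" "q < 1" 
  proof -
    have "2 * norm y / norm \<beta> < real K" using K by simp
    then have "2 * norm y < norm \<beta> * real K" using False by (simp add: field_simps)
    then have "norm y < norm \<beta> * real K" using norm_ge_zero[of y] by linarith
    then show "0 \<le> q" "q < 1" unfolding q_def using False K0
      by (auto simp: divide_less_eq)
  qed
  have prod: "d * (norm \<beta> * real K) ^ N \<le> norm (\<Prod>m\<le>N. divisor \<alpha> \<beta> \<gamma> m n)" for N n
  proof -
    have "d * (norm \<beta> * real K) ^ N = norm \<beta> ^ Suc N * ((\<delta> / K) ^ (2 * K + 1) * real K ^ Suc N)"
      by (simp add: d_def power_mult_distrib)
    also have "\<dots> \<le> norm \<beta> ^ Suc N * (\<Prod>m\<le>N. norm (s + of_nat n * r + of_nat m))"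
      using \<delta> \<delta>K by (intro mult_left_mono prod_norm_translates_lower_bound) (auto simp: add_ac)
    also have "\<dots> = norm (\<Prod>m\<le>N. divisor \<alpha> \<beta> \<gamma> m n)"
      by (simp add: div norm_mult norm_power prod_norm[symmetric] prod.distrib)
    finally show ?thesis .
  qed
  let ?C = "\<Sum>n. norm (c n * z ^ n)"
  have bound: "norm (y ^ N * (\<Sum>n. divided_coeff \<alpha> \<beta> \<gamma> c N n * z ^ n)) \<le> ?C / d * q ^ N" for N
  proof -
    let ?p = "d * (norm \<beta> * real K) ^ N"
    have p0: "?p > 0" using d0 K0 False by simp
    have "norm (divided_coeff \<alpha> \<beta> \<gamma> c N n * z ^ n) \<le> norm (c n * z ^ n) / ?p" for n
    proof -
      have "norm (divided_coeff \<alpha> \<beta> \<gamma> c N n * z ^ n) = norm (c n * z ^ n) / norm (\<Prod>m\<le>N. divisor \<alpha> \<beta> \<gamma> m n)"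
        by (simp add: divided_coeff_def norm_mult norm_divide)
      also have "\<dots> \<le> norm (c n * z ^ n) / ?p"
        using prod by (intro divide_left_mono mult_pos_pos[OF _ p0]) (auto simp: nz)
      finally show ?thesis .
    qed
    then have "norm (\<Sum>n. divided_coeff \<alpha> \<beta> \<gamma> c N n * z ^ n) \<le> (\<Sum>n. norm (c n * z ^ n) / ?p)"
      by (intro norm_suminf_le summable_divide c)
    also have "\<dots> = ?C / ?p" using suminf_divide[OF c] by simp
    finally have "norm (y ^ N * (\<Sum>n. divided_coeff \<alpha> \<beta> \<gamma> c N n * z ^ n)) \<le> norm y ^ N * (?C / ?p)"
      unfolding norm_mult norm_power by (intro mult_left_mono) auto
    also have "\<dots> = ?C / d * q ^ N"
      by (simp add: q_def power_divide)
    finally show ?thesis .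
  qed
  have "summable (\<lambda>N. ?C / d * q ^ N)"
    using q by (intro summable_mult summable_geometric) simp
  then show ?thesis
    by (rule summable_comparison_test') (use bound in simp)
qed

lemma pochhammer_ratio_shift:
  fixes u :: complex
  assumes "\<And>n. u + of_nat n \<noteq> 0"
  shows "pochhammer u n / pochhammer (u + 1) n = u / (u + of_nat n)"
proof -
  have "u + 1 + of_nat k \<noteq> 0" for k using assms[of "Suc k"] by (simp add: add_ac)
  then have "pochhammer (u + 1) n \<noteq> 0"
    by (simp add: pochhammer_eq_0_iff) (metis add_eq_0_iff2 minus_equation_iff)
  moreover have "u * pochhammer (u + 1) n = pochhammer u n * (u + of_nat n)"
    using pochhammer_rec[of u n] pochhammer_Suc[of u n] by simp
  ultimately show ?thesis using assms[of n] by (simp add: field_simps)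
qed

text \<open>
  Each pair of additional parameters has the form $u$, $u+1$ with $u = D_{m,0}/\gamma$, and
  contributes the factor $u/(u+n) = D_{m,0}/D_{m,n}$.
\<close>

lemma hypergeo_term_extended_params:
  assumes \<gamma>: "\<gamma> \<noteq> 0" and nz: "\<And>m n. divisor \<alpha> \<beta> \<gamma> m n \<noteq> 0"
  shows "hypergeo_term (upper_params as \<alpha> \<beta> \<gamma> N) (lower_params bs \<alpha> \<beta> \<gamma> N) (lam * \<zeta>) n =
         (\<Prod>m\<le>N. divisor \<alpha> \<beta> \<gamma> m 0) *
           (divided_coeff \<alpha> \<beta> \<gamma> (\<lambda>n. fps_nth (fps_hypergeo as bs 1) n * lam ^ n) N n * \<zeta> ^ n)"
proof -
  define u where "u m = (\<alpha> + of_nat m * \<beta> + 1) / \<gamma>" for m :: nat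
  have u_shift: "(\<alpha> + \<gamma> + of_nat m * \<beta> + 1) / \<gamma> = u m + 1" for m
    using \<gamma> by (simp add: u_def field_simps)
  have div: "divisor \<alpha> \<beta> \<gamma> m k = \<gamma> * (u m + of_nat k)" for m k
    using \<gamma> by (simp add: u_def divisor_def field_simps)
  have u_nz: "u m + of_nat k \<noteq> 0" for m k using nz[of m k] unfolding div by simp
  have lists: "(\<Prod>a\<leftarrow>map f [0..<Suc N]. pochhammer a n) = (\<Prod>m\<le>N. pochhammer (f m) n)" for f :: "nat \<Rightarrow> complex"
  proof -
    have "(\<Prod>a\<leftarrow>map f [0..<Suc N]. pochhammer a n) = (\<Prod>m\<in>set [0..<Suc N]. pochhammer (f m) n)"
      by (subst prod.distinct_set_conv_list) (simp_all add: o_def)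
    also have "set [0..<Suc N] = {..N}" by auto
    finally show ?thesis .
  qed
  have "hypergeo_term (upper_params as \<alpha> \<beta> \<gamma> N) (lower_params bs \<alpha> \<beta> \<gamma> N) (lam * \<zeta>) n =
      hypergeo_term as bs (lam * \<zeta>) n * ((\<Prod>m\<le>N. pochhammer (u m) n) / (\<Prod>m\<le>N. pochhammer (u m + 1) n))"
    unfolding hypergeo_term_altdef upper_params_def lower_params_def u_shift u_def[symmetric]
      map_append prod_list.append lists by (simp add: mult_ac)
  also have "(\<Prod>m\<le>N. pochhammer (u m) n) / (\<Prod>m\<le>N. pochhammer (u m + 1) n) =
      (\<Prod>m\<le>N. divisor \<alpha> \<beta> \<gamma> m 0 / divisor \<alpha> \<beta> \<gamma> m n)"
    unfolding prod_dividef[symmetric] div using \<gamma> u_nz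
    by (intro prod.cong refl) (simp add: pochhammer_ratio_shift)
  finally show ?thesis
    by (simp add: hypergeo_term_def divided_coeff_def prod_dividef power_mult_distrib)
qed

lemma F_fun_conv_divided_series:
  assumes \<gamma>: "\<gamma> \<noteq> 0" and nz: "\<And>m n. divisor \<alpha> \<beta> \<gamma> m n \<noteq> 0"
    and c: "summable (\<lambda>n. norm (hypergeo_term as bs (lam * \<zeta>) n))"
  shows "summable (hypergeo_term (upper_params as \<alpha> \<beta> \<gamma> N) (lower_params bs \<alpha> \<beta> \<gamma> N) (lam * \<zeta>))" (is ?conv)
    and "F_fun as bs \<alpha> \<beta> \<gamma> N (lam * \<zeta>) / (\<Prod>m=0..N. \<alpha> + of_nat m * \<beta> + 1) =
      (\<Sum>n. divided_coeff \<alpha> \<beta> \<gamma> (\<lambda>n. fps_nth (fps_hypergeo as bs 1) n * lam ^ n) N n * \<zeta> ^ n)" (is ?sum)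
proof -
  let ?d = "\<lambda>n. divided_coeff \<alpha> \<beta> \<gamma> (\<lambda>n. fps_nth (fps_hypergeo as bs 1) n * lam ^ n) N n * \<zeta> ^ n"
  have "summable (\<lambda>n. norm (?d n))"
    using c by (intro divided_coeff_summable \<gamma>) (simp add: hypergeo_term_def power_mult_distrib mult.assoc)
  then have d: "summable ?d" by (rule summable_norm_cancel)
  have eq: "hypergeo_term (upper_params as \<alpha> \<beta> \<gamma> N) (lower_params bs \<alpha> \<beta> \<gamma> N) (lam * \<zeta>) =
      (\<lambda>n. (\<Prod>m\<le>N. divisor \<alpha> \<beta> \<gamma> m 0) * ?d n)"
    by (rule ext) (rule hypergeo_term_extended_params[OF \<gamma> nz])
  show ?conv unfolding eq by (rule summable_mult[OF d])
  have "F_fun as bs \<alpha> \<beta> \<gamma> N (lam * \<zeta>) = (\<Prod>m\<le>N. divisor \<alpha> \<beta> \<gamma> m 0) * (\<Sum>n. ?d n)"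
    unfolding F_fun_def hypergeo_altdef eq by (rule suminf_mult[OF d])
  moreover have "(\<Prod>m\<le>N. divisor \<alpha> \<beta> \<gamma> m 0) = (\<Prod>m=0..N. \<alpha> + of_nat m * \<beta> + 1)"
    by (simp add: divisor_def atLeast0AtMost)
  moreover have "(\<Prod>m\<le>N. divisor \<alpha> \<beta> \<gamma> m 0) \<noteq> 0" using nz by simp
  ultimately show ?sum by simp
qed

section \<open>The antiderivative\<close>

text \<open>
  With $\kappa = \beta\eta$ this is the $N$-th term of the antiderivative, up to its sign and the
  factor $\sin(\eta x^\beta)$ or $\cos(\eta x^\beta)$; see \<open>iterated_primitive_conv_F_fun\<close>.
\<close>

definition iterated_primitive ::
    "(complex \<Rightarrow> complex) \<Rightarrow> (nat \<Rightarrow> complex) \<Rightarrow> complex \<Rightarrow> complex \<Rightarrow> complex \<Rightarrow> complex \<Rightarrow> nat \<Rightarrow> complex \<Rightarrow> complex"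
  where "iterated_primitive L c \<alpha> \<beta> \<gamma> \<kappa> N x =
    \<kappa> ^ N * (branch_pow L x (\<alpha> + 1 + of_nat N * \<beta>) *
      (\<Sum>n. divided_coeff \<alpha> \<beta> \<gamma> c N n * branch_pow L x \<gamma> ^ n))"

text \<open>
  The exponent of the \<open>n\<close>-th monomial is the divisor with indices \<open>N\<close> and \<open>n\<close>,
  so the factor produced by differentiation cancels the last divisor in the coefficient.
\<close>

lemma iterated_primitive_derivative:
  assumes L: "(L has_field_derivative 1 / x) (at x)" and x: "exp (L x) = x"
    and \<gamma>: "\<gamma> \<noteq> 0" and nz: "\<And>m n. divisor \<alpha> \<beta> \<gamma> m n \<noteq> 0"
    and c: "summable (\<lambda>n. norm (c n * K ^ n))" and K: "norm (branch_pow L x \<gamma>) < norm K"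
  shows "(iterated_primitive L c \<alpha> \<beta> \<gamma> \<kappa> 0 has_field_derivative
            branch_pow L x \<alpha> * (\<Sum>n. c n * branch_pow L x \<gamma> ^ n)) (at x)"
    and "(iterated_primitive L c \<alpha> \<beta> \<gamma> \<kappa> (Suc N) has_field_derivative
            \<kappa> * branch_pow L x \<beta> / x * iterated_primitive L c \<alpha> \<beta> \<gamma> \<kappa> N x) (at x)"
proof -
  have "x \<noteq> 0" using x by auto
  have deriv: "(iterated_primitive L c \<alpha> \<beta> \<gamma> \<kappa> N has_field_derivative
      \<kappa> ^ N * (branch_pow L x (\<alpha> + 1 + of_nat N * \<beta>) / x *
        (\<Sum>n. divisor \<alpha> \<beta> \<gamma> N n * divided_coeff \<alpha> \<beta> \<gamma> c N n * branch_pow L x \<gamma> ^ n))) (at x)" for N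
  proof -
    have "summable (\<lambda>n. divided_coeff \<alpha> \<beta> \<gamma> c N n * K ^ n)"
      using divided_coeff_summable[OF \<gamma> c] by (rule summable_norm_cancel)
    from DERIV_cmult[OF branch_pow_series_derivative[OF L this K, of "\<alpha> + 1 + of_nat N * \<beta>"], of "\<kappa> ^ N"]
    show ?thesis
      unfolding iterated_primitive_def[abs_def] by (simp add: divisor_def add_ac mult_ac)
  qed
  have "divisor \<alpha> \<beta> \<gamma> 0 n * divided_coeff \<alpha> \<beta> \<gamma> c 0 n = c n" for n
    using nz[of 0 n] by (simp add: divided_coeff_def)
  with deriv[of 0] \<open>x \<noteq> 0\<close> x show "(iterated_primitive L c \<alpha> \<beta> \<gamma> \<kappa> 0 has_field_derivative
            branch_pow L x \<alpha> * (\<Sum>n. c n * branch_pow L x \<gamma> ^ n)) (at x)"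
    by (simp add: branch_pow_add branch_pow_1)
  have "divisor \<alpha> \<beta> \<gamma> (Suc N) n * divided_coeff \<alpha> \<beta> \<gamma> c (Suc N) n = divided_coeff \<alpha> \<beta> \<gamma> c N n" for n
    using nz[of "Suc N" n] by (simp add: divided_coeff_def)
  moreover have "branch_pow L x (\<alpha> + 1 + of_nat (Suc N) * \<beta>) = branch_pow L x (\<alpha> + 1 + of_nat N * \<beta>) * branch_pow L x \<beta>"
    by (simp add: branch_pow_add[symmetric] algebra_simps)
  ultimately show "(iterated_primitive L c \<alpha> \<beta> \<gamma> \<kappa> (Suc N) has_field_derivative
            \<kappa> * branch_pow L x \<beta> / x * iterated_primitive L c \<alpha> \<beta> \<gamma> \<kappa> N x) (at x)"
    using deriv[of "Suc N"] by (simp add: iterated_primitive_def mult_ac)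
qed

lemma iterated_primitive_conv_F_fun:
  assumes "\<gamma> \<noteq> 0" "\<And>m n. divisor \<alpha> \<beta> \<gamma> m n \<noteq> 0"
    and "summable (\<lambda>n. norm (hypergeo_term as bs (lam * branch_pow L x \<gamma>) n))"
  shows "iterated_primitive L (\<lambda>n. fps_nth (fps_hypergeo as bs 1) n * lam ^ n) \<alpha> \<beta> \<gamma> (\<beta> * \<eta>) N x =
    branch_pow L x (\<alpha> + 1) * ((\<beta> * \<eta> * branch_pow L x \<beta>) ^ N / (\<Prod>m=0..N. \<alpha> + of_nat m * \<beta> + 1)
      * F_fun as bs \<alpha> \<beta> \<gamma> N (lam * branch_pow L x \<gamma>))"
  unfolding iterated_primitive_def F_fun_conv_divided_series(2)[OF assms, symmetric]
  by (simp add: branch_pow_add branch_pow_of_nat_mult power_mult_distrib)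

lemma summable_alternating_subsequence:
  fixes f :: "nat \<Rightarrow> complex"
  assumes "summable (\<lambda>N. norm (f N))" "inj g"
  shows "summable (\<lambda>j. (-1) ^ j * f (g j))"
proof (rule summable_norm_cancel)
  show "summable (\<lambda>j. norm ((-1) ^ j * f (g j)))"
    using summable_reindex[OF assms] by (simp add: o_def norm_mult norm_power)
qed

lemma antiderivative_on_connected_iff:
  assumes S: "open S" "connected S" and P: "antiderivative_on P f S"
  shows "antiderivative_on G f S \<longleftrightarrow> (\<exists>C. \<forall>x\<in>S. G x = P x + C)"
proof
  assume G: "antiderivative_on G f S"
  have d: "((\<lambda>x. G x - P x) has_field_derivative 0) (at x)" if "x \<in> S" for x
    using DERIV_diff[of G "f x" x UNIV P "f x"] G P that by (simp add: antiderivative_on_def)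
  then have "continuous_on S (\<lambda>x. G x - P x)"
    by (meson DERIV_isCont continuous_at_imp_continuous_on)
  from DERIV_zero_connected_constant[OF S(2,1) finite.emptyI this]
  obtain C where "\<And>x. x \<in> S \<Longrightarrow> G x - P x = C" using d by auto
  then show "\<exists>C. \<forall>x\<in>S. G x = P x + C"
    by (metis add.commute diff_add_cancel)
next
  assume "\<exists>C. \<forall>x\<in>S. G x = P x + C"
  then obtain C where C: "\<And>x. x \<in> S \<Longrightarrow> P x + C = G x" by auto
  show "antiderivative_on G f S"
    unfolding antiderivative_on_def
  proof
    fix x assume x: "x \<in> S"
    have "((\<lambda>x. P x + C) has_field_derivative f x) (at x)"
      using DERIV_add[OF _ DERIV_const, of P "f x" x UNIV C] P x by (simp add: antiderivative_on_def)
    then show "(G has_field_derivative f x) (at x)"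
      by (rule has_field_derivative_transform_within_open[OF _ S(1) x]) (rule C)
  qed
qed

theorem proposition5:
  fixes as bs :: "complex list" and \<alpha> \<beta> \<gamma> \<eta> lam :: complex
    and S :: "complex set" and L :: "complex \<Rightarrow> complex"
  assumes gamma: "\<gamma> \<noteq> 0"
    and domain: "open S" "connected S"
    and branch: "L holomorphic_on S" "\<And>x. x \<in> S \<Longrightarrow> exp (L x) = x"
    and lower: "\<And>b. b \<in> set bs \<Longrightarrow> b \<notin> \<int>\<^sub>\<le>\<^sub>0"
    and lower_F: "\<And>m::nat. (\<alpha> + \<gamma> + of_nat m * \<beta> + 1) / \<gamma> \<notin> \<int>\<^sub>\<le>\<^sub>0"
    and denom: "\<And>m::nat. \<alpha> + of_nat m * \<beta> + 1 \<noteq> 0"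
    and conv: "\<And>x. x \<in> S \<Longrightarrow> summable (hypergeo_term as bs (lam * branch_pow L x \<gamma>))"
    and conv_small_divisors:
      "\<And>x. small_divisors \<alpha> \<beta> \<gamma> \<Longrightarrow> x \<in> S \<Longrightarrow>
         summable (even_term as bs \<alpha> \<beta> \<gamma> \<eta> (branch_pow L x \<beta>) (lam * branch_pow L x \<gamma>)) \<and>
         summable (odd_term as bs \<alpha> \<beta> \<gamma> \<eta> (branch_pow L x \<beta>) (lam * branch_pow L x \<gamma>))"
  shows
    "(\<forall>x\<in>S.
        (\<forall>N. summable (hypergeo_term (upper_params as \<alpha> \<beta> \<gamma> N) (lower_params bs \<alpha> \<beta> \<gamma> N)
                         (lam * branch_pow L x \<gamma>))) \<and>
        summable (even_term as bs \<alpha> \<beta> \<gamma> \<eta> (branch_pow L x \<beta>) (lam * branch_pow L x \<gamma>)) \<and>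
        summable (odd_term as bs \<alpha> \<beta> \<gamma> \<eta> (branch_pow L x \<beta>) (lam * branch_pow L x \<gamma>))) \<and>
     (\<forall>G. antiderivative_on G
            (\<lambda>x. branch_pow L x \<alpha> * sin (\<eta> * branch_pow L x \<beta>)
                   * hypergeo as bs (lam * branch_pow L x \<gamma>)) S \<longleftrightarrow>
          (\<exists>C. \<forall>x\<in>S. G x =
              branch_pow L x (\<alpha> + 1) * sin (\<eta> * branch_pow L x \<beta>)
                * (\<Sum>j. even_term as bs \<alpha> \<beta> \<gamma> \<eta> (branch_pow L x \<beta>) (lam * branch_pow L x \<gamma>) j)
            - branch_pow L x (\<alpha> + 1) * cos (\<eta> * branch_pow L x \<beta>)
                * (\<Sum>j. odd_term as bs \<alpha> \<beta> \<gamma> \<eta> (branch_pow L x \<beta>) (lam * branch_pow L x \<gamma>) j)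
            + C))"
proof -
  define c where "c n = fps_nth (fps_hypergeo as bs 1) n * lam ^ n" for n
  define T where "T = iterated_primitive L c \<alpha> \<beta> \<gamma> (\<beta> * \<eta>)"
  let ?even = "\<lambda>x. even_term as bs \<alpha> \<beta> \<gamma> \<eta> (branch_pow L x \<beta>) (lam * branch_pow L x \<gamma>)"
  let ?odd = "\<lambda>x. odd_term as bs \<alpha> \<beta> \<gamma> \<eta> (branch_pow L x \<beta>) (lam * branch_pow L x \<gamma>)"
  have term_eq: "hypergeo_term as bs (lam * z) = (\<lambda>n. c n * z ^ n)" for z
    by (rule ext) (simp only: hypergeo_term_def c_def power_mult_distrib mult.assoc)
  \<comment> \<open>The hypothesis on the lower parameters of \<open>F_N\<close> covers positive \<open>n\<close>, \<open>denom\<close> covers \<open>n = 0\<close>.\<close>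
  have nz: "divisor \<alpha> \<beta> \<gamma> m n \<noteq> 0" for m n
  proof (cases n)
    case 0
    then show ?thesis using denom by (simp add: divisor_def)
  next
    case (Suc k)
    show ?thesis
    proof
      assume "divisor \<alpha> \<beta> \<gamma> m n = 0"
      then have "\<alpha> + \<gamma> + of_nat m * \<beta> + 1 = - of_nat k * \<gamma>"
        using Suc by (simp add: divisor_def eq_neg_iff_add_eq_0 algebra_simps)
      then have "(\<alpha> + \<gamma> + of_nat m * \<beta> + 1) / \<gamma> = - of_nat k"
        using gamma by simp
      then show False using lower_F[of m] by auto
    qed
  qed
  have L: "(L has_field_derivative 1 / x) (at x)" if "x \<in> S" for x
    by (rule branch_derivative[OF domain(1) branch that])
  have interior: "\<exists>K. norm (branch_pow L x \<gamma>) < norm K \<and> summable (\<lambda>n. norm (c n * K ^ n))"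
    if "x \<in> S" for x
  proof -
    obtain y where y: "y \<in> S" "norm (branch_pow L x \<gamma>) < norm (branch_pow L y \<gamma>)"
      using branch_pow_norm_increases[OF domain branch gamma \<open>x \<in> S\<close>] by blast
    \<comment> \<open>A second step is needed since at the outermost point convergence may be conditional.\<close>
    obtain w where w: "w \<in> S" "norm (branch_pow L y \<gamma>) < norm (branch_pow L w \<gamma>)"
      using branch_pow_norm_increases[OF domain branch gamma y(1)] by blast
    have "summable (\<lambda>n. norm (c n * branch_pow L y \<gamma> ^ n))"
      using conv[OF w(1)] w(2) unfolding term_eq by (rule powser_insidea)
    with y show ?thesis by blast
  qed
  have abs: "summable (\<lambda>n. norm (c n * branch_pow L x \<gamma> ^ n))" if "x \<in> S" for x
  proof -
    obtain K where K: "norm (branch_pow L x \<gamma>) < norm K" "summable (\<lambda>n. norm (c n * K ^ n))"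
      using interior[OF \<open>x \<in> S\<close>] by blast
    show ?thesis by (rule powser_insidea[OF summable_norm_cancel[OF K(2)] K(1)])
  qed
  have T_eq: "T N x = branch_pow L x (\<alpha> + 1) *
      ((\<beta> * \<eta> * branch_pow L x \<beta>) ^ N / (\<Prod>m=0..N. \<alpha> + of_nat m * \<beta> + 1)
        * F_fun as bs \<alpha> \<beta> \<gamma> N (lam * branch_pow L x \<gamma>))" if "x \<in> S" for N x
    unfolding T_def c_def[abs_def] using abs[OF that]
    by (intro iterated_primitive_conv_F_fun gamma nz) (simp add: term_eq)
  have T_even: "(-1) ^ j * T (2 * j) x = branch_pow L x (\<alpha> + 1) * ?even x j"
    and T_odd: "(-1) ^ j * T (2 * j + 1) x = branch_pow L x (\<alpha> + 1) * ?odd x j" if "x \<in> S" for j x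
    unfolding T_eq[OF that] even_term_def odd_term_def by (simp_all only: mult_ac times_divide_eq_right)
  have conv_F: "summable (hypergeo_term (upper_params as \<alpha> \<beta> \<gamma> N) (lower_params bs \<alpha> \<beta> \<gamma> N)
                         (lam * branch_pow L x \<gamma>))" if "x \<in> S" for N x
    using abs[OF that] by (intro F_fun_conv_divided_series gamma nz) (simp add: term_eq)
  have conv_terms: "summable (?even x) \<and> summable (?odd x)" if x: "x \<in> S" for x
  proof (cases "small_divisors \<alpha> \<beta> \<gamma>")
    case True
    then show ?thesis using conv_small_divisors x by blast
  next
    case False
    let ?y = "\<beta> * \<eta> * branch_pow L x \<beta>"
    let ?u = "\<lambda>N. ?y ^ N * (\<Sum>n. divided_coeff \<alpha> \<beta> \<gamma> c N n * branch_pow L x \<gamma> ^ n)"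
    have u: "summable (\<lambda>N. norm (?u N))"
      by (rule divided_series_summable[OF gamma nz False abs[OF x]]) simp
    have F: "F_fun as bs \<alpha> \<beta> \<gamma> N (lam * branch_pow L x \<gamma>) / (\<Prod>m=0..N. \<alpha> + of_nat m * \<beta> + 1) =
        (\<Sum>n. divided_coeff \<alpha> \<beta> \<gamma> c N n * branch_pow L x \<gamma> ^ n)" for N
      unfolding c_def[abs_def] using abs[OF x]
      by (intro F_fun_conv_divided_series gamma nz) (simp add: term_eq)
    have "?even x = (\<lambda>j. (-1) ^ j * ?u (2 * j))" "?odd x = (\<lambda>j. (-1) ^ j * ?u (2 * j + 1))"
      unfolding even_term_def odd_term_def F[symmetric] by (simp_all add: fun_eq_iff)
    moreover have "summable (\<lambda>j. (-1) ^ j * ?u (2 * j))" "summable (\<lambda>j. (-1) ^ j * ?u (2 * j + 1))"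
      by (rule summable_alternating_subsequence[OF u]; simp add: inj_on_def)+
    ultimately show ?thesis by simp
  qed
  let ?P = "\<lambda>x. branch_pow L x (\<alpha> + 1) * sin (\<eta> * branch_pow L x \<beta>) * (\<Sum>j. ?even x j)
            - branch_pow L x (\<alpha> + 1) * cos (\<eta> * branch_pow L x \<beta>) * (\<Sum>j. ?odd x j)"
  have "antiderivative_on ?P
      (\<lambda>x. branch_pow L x \<alpha> * sin (\<eta> * branch_pow L x \<beta>) * hypergeo as bs (lam * branch_pow L x \<gamma>)) S"
    unfolding antiderivative_on_def
  proof
    fix x assume x: "x \<in> S"
    let ?\<omega> = "\<lambda>x. \<beta> * \<eta> * branch_pow L x \<beta> / x"
    have T_deriv: "(T 0 has_field_derivative branch_pow L z \<alpha> * (\<Sum>n. c n * branch_pow L z \<gamma> ^ n)) (at z)"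
        "(T (Suc N) has_field_derivative ?\<omega> z * T N z) (at z)" if z: "z \<in> S" for z N
    proof -
      obtain K where "norm (branch_pow L z \<gamma>) < norm K" "summable (\<lambda>n. norm (c n * K ^ n))"
        using interior[OF z] by blast
      note d = iterated_primitive_derivative[OF L[OF z] branch(2)[OF z] gamma nz this(2,1)]
      show "(T 0 has_field_derivative branch_pow L z \<alpha> * (\<Sum>n. c n * branch_pow L z \<gamma> ^ n)) (at z)"
        "(T (Suc N) has_field_derivative ?\<omega> z * T N z) (at z)"
        unfolding T_def by (rule d)+
    qed
    have sums: "(\<Sum>j. (-1) ^ j * T (2 * j) z) = branch_pow L z (\<alpha> + 1) * (\<Sum>j. ?even z j)"
      "(\<Sum>j. (-1) ^ j * T (2 * j + 1) z) = branch_pow L z (\<alpha> + 1) * (\<Sum>j. ?odd z j)"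
      if z: "z \<in> S" for z
      unfolding T_even[OF z] T_odd[OF z] using conv_terms[OF z] by (simp_all add: suminf_mult)
    have "((\<lambda>x. sin (\<eta> * branch_pow L x \<beta>) * (\<Sum>j. (-1) ^ j * T (2 * j) x)
             - cos (\<eta> * branch_pow L x \<beta>) * (\<Sum>j. (-1) ^ j * T (2 * j + 1) x))
          has_field_derivative
            branch_pow L x \<alpha> * (\<Sum>n. c n * branch_pow L x \<gamma> ^ n) * sin (\<eta> * branch_pow L x \<beta>)) (at x)"
    proof (rule alternating_primitives_derivative[OF domain(1) x])
      show "((\<lambda>x. \<eta> * branch_pow L x \<beta>) has_field_derivative ?\<omega> z) (at z)" if "z \<in> S" for z
        by (rule DERIV_cong[OF DERIV_cmult[OF branch_pow_derivative[OF L[OF that]]]]) simp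
      have "0 \<notin> S" using branch(2)[of 0] by auto
      then show "continuous_on S ?\<omega>"
        unfolding branch_pow_def using holomorphic_on_imp_continuous_on[OF branch(1)]
        by (intro continuous_intros) auto
      show "summable (\<lambda>j. (-1) ^ j * T (2 * j) z)" "summable (\<lambda>j. (-1) ^ j * T (2 * j + 1) z)"
        if z: "z \<in> S" for z
        unfolding T_even[OF z] T_odd[OF z] using conv_terms[OF z] by (auto intro: summable_mult)
    qed (rule T_deriv; assumption)+
    then have "((\<lambda>x. sin (\<eta> * branch_pow L x \<beta>) * (\<Sum>j. (-1) ^ j * T (2 * j) x)
             - cos (\<eta> * branch_pow L x \<beta>) * (\<Sum>j. (-1) ^ j * T (2 * j + 1) x))
          has_field_derivative
            branch_pow L x \<alpha> * sin (\<eta> * branch_pow L x \<beta>) * hypergeo as bs (lam * branch_pow L x \<gamma>)) (at x)"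
      by (simp add: hypergeo_altdef term_eq mult_ac)
    then show "(?P has_field_derivative
            branch_pow L x \<alpha> * sin (\<eta> * branch_pow L x \<beta>) * hypergeo as bs (lam * branch_pow L x \<gamma>)) (at x)"
      by (rule has_field_derivative_transform_within_open[OF _ domain(1) x]) (simp only: sums, simp only: mult_ac)
  qed
  from antiderivative_on_connected_iff[OF domain this] conv_F conv_terms show ?thesis
    by simp
qed

end
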